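(* Consider $n$ single-integrator agents $\dot x_i(t)=u_i(t)$, $x_i(t)\in\mathbb{R}$, $i=1,\dots,n$, with undirected simple interaction graph $\mathcal{G}$, under the broadcasting protocol (with gain $K=1$) $$u_i(t)=\sum_{j\in\mathcal{N}_i}(\hat x_j(t)-\hat x_i(t)),$$ where, without measurement errors, $\hat x_i(t)=x_i(t^i_k)$ for $t\in[t^i_k+\tau^i_k,\,t^i_{k+1}+\tau^i_{k+1})$, $k=0,1,2,\dots$. Suppose that for every $i=1,\dots,n$ and every $k=0,1,2,\dots$: (1) $t^i_{k+1}-t^i_k\le h$; (2) $\tau^i_k<t^i_{k+1}-t^i_k$; (3) $\tau^i_k\le\tau$. Let $0=\lambda_1\le\lambda_2\le\dots\le\lambda_n$ be the eigenvalues of the graph Laplacian of $\mathcal{G}$ and $\sigma=\max\{2\lambda_2,\lambda_n-2\lambda_2\}$. If $\mathcal{G}$ is connected and $$(h+\tau)^2<\frac{3}{7\lambda_n^2}\,\sup_{\gamma>0}\frac{\lambda_2-\frac{\sigma}{2\gamma}}{\frac{\gamma\sigma}{2}+\lambda_n-\lambda_2},$$ then the protocol solves the average consensus problem, i.e. for every $i$, $$\lim_{t\to\infty}\Big(x_i(t)-\frac1n\sum_{j=1}^nx_j(0)\Big)=0.$$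
   Context: $\mathcal{N}_i$ is the set of neighbors of vertex $i$ in $\mathcal{G}$ (vertices = agents). The graph Laplacian is $DD^T$ with $D$ an (arbitrarily oriented) incidence matrix of $\mathcal{G}$. For each agent $i$, $0\le t^i_0<t^i_1<\cdots$ are the instants at which agent $i$ samples its own state (with $t^i_k\to\infty$ as $k\to\infty$) and $\tau^i_k\ge0$ are the delays after which the broadcast sample is simultaneously used by agent $i$ and all its neighbors; sequences for different agents are independent (no relation between different agents is assumed). As long as $\hat x_i(t)$ or $\hat x_j(t)$ is not yet defined (no data received), the term $\hat x_j-\hat x_i$ is taken to be zero. $h>0$ is the maximum sampling period and $\tau\ge0$ the maximum delay. *)

theory Defs
  imports "HOL-Analysis.Analysis"
begin

definition simple_graph :: "'n::finite set set \<Rightarrow> bool" where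
  "simple_graph E \<longleftrightarrow> (\<forall>e\<in>E. card e = 2)"

definition neighbors :: "'n::finite set set \<Rightarrow> 'n \<Rightarrow> 'n set" where
  "neighbors E i = {j. {i, j} \<in> E}"

definition connected_graph :: "'n::finite set set \<Rightarrow> bool" where
  "connected_graph E \<longleftrightarrow> (\<forall>i j. rtranclp (\<lambda>a b. {a, b} \<in> E) i j)"

text \<open>The columns of \<open>D\<close> are indexed by the edges; the values of \<open>D\<close> on non-edges are
  irrelevant. Any orientation is allowed.\<close>

definition incidence_matrix :: "'n::finite set set \<Rightarrow> ('n \<Rightarrow> 'n set \<Rightarrow> real) \<Rightarrow> bool" where
  "incidence_matrix E D \<longleftrightarrow>
     (\<forall>e\<in>E. \<exists>a b. a \<noteq> b \<and> e = {a, b} \<and> D a e = 1 \<and> D b e = - 1 \<and> (\<forall>i. i \<notin> e \<longrightarrow> D i e = 0))"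

text \<open>The matrix product of \<open>D\<close> with its transpose.\<close>

definition laplacian :: "'n::finite set set \<Rightarrow> ('n \<Rightarrow> 'n set \<Rightarrow> real) \<Rightarrow> real^'n^'n" where
  "laplacian E D = (\<chi> i j. \<Sum>e\<in>E. D i e * D j e)"

text \<open>\<open>lam 1 \<le> \<dots> \<le> lam n\<close> are the eigenvalues of \<open>A\<close>, listed with multiplicity as the roots of
  the characteristic polynomial.\<close>

definition ordered_eigenvalues :: "real^'n^'n \<Rightarrow> (nat \<Rightarrow> real) \<Rightarrow> bool" where
  "ordered_eigenvalues A lam \<longleftrightarrow>
     mono_on {1..CARD('n)} lam \<and>
     (\<forall>z. det (mat z - A) = (\<Prod>k = 1..CARD('n). (z - lam k)))"

text \<open>For one agent with sampling instants \<open>T\<close> and delays \<open>d\<close>: the period during which sample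
  \<open>k\<close> of its state trajectory \<open>y\<close> is in use, and the resulting held signal, which is \<open>None\<close>
  before the first sample arrives.\<close>

definition hold_period :: "(nat \<Rightarrow> real) \<Rightarrow> (nat \<Rightarrow> real) \<Rightarrow> nat \<Rightarrow> real set" where
  "hold_period T d k = {T k + d k ..< T (Suc k) + d (Suc k)}"

definition held :: "(nat \<Rightarrow> real) \<Rightarrow> (nat \<Rightarrow> real) \<Rightarrow> (real \<Rightarrow> real) \<Rightarrow> real \<Rightarrow> real option" where
  "held T d y t =
     (if \<exists>k. t \<in> hold_period T d k
      then Some (y (T (THE k. t \<in> hold_period T d k))) else None)"

lemma held_eq:
  assumes T: "\<And>k. T k < T (Suc k)" and d: "\<And>k. 0 \<le> d k" "\<And>k. d k < T (Suc k) - T k"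
    and t: "t \<in> hold_period T d k"
  shows "held T d y t = Some (y (T k))"
proof -
  have "strict_mono (\<lambda>k. T k + d k)"
  proof (rule strict_mono_Suc_iff[THEN iffD2], rule allI)
    show "T k + d k < T (Suc k) + d (Suc k)" for k
      using d(1)[of "Suc k"] d(2)[of k] by linarith
  qed
  then have mono: "T a + d a \<le> T b + d b" if "a \<le> b" for a b
    using that by (rule monoD[OF strict_mono_mono])
  have "l = k" if "t \<in> hold_period T d l" for l
  proof (rule ccontr)
    assume "l \<noteq> k"
    then consider "Suc l \<le> k" | "Suc k \<le> l" by linarith
    then show False
      using mono[of "Suc l" k] mono[of "Suc k" l] that t
      by cases (auto simp: hold_period_def)
  qed
  then have "(THE l. t \<in> hold_period T d l) = k"
    using t by blast
  then show ?thesis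
    using t by (auto simp: held_def)
qed

definition broadcast_control ::
  "'n::finite set set \<Rightarrow> ('n \<Rightarrow> nat \<Rightarrow> real) \<Rightarrow> ('n \<Rightarrow> nat \<Rightarrow> real) \<Rightarrow> ('n \<Rightarrow> real \<Rightarrow> real) \<Rightarrow> 'n \<Rightarrow> real \<Rightarrow> real"
where
  "broadcast_control E T d x i t =
     (\<Sum>j\<in>neighbors E i.
        case (held (T j) (d j) (x j) t, held (T i) (d i) (x i) t) of
          (Some a, Some b) \<Rightarrow> a - b
        | _ \<Rightarrow> 0)"

text \<open>The control is piecewise constant and jumps only at update instants \<open>T j k + d j k\<close>, so the
  differential equation is imposed off these instants, together with continuity.\<close>

definition closed_loop_solution ::
  "'n::finite set set \<Rightarrow> ('n \<Rightarrow> nat \<Rightarrow> real) \<Rightarrow> ('n \<Rightarrow> nat \<Rightarrow> real) \<Rightarrow> ('n \<Rightarrow> real \<Rightarrow> real) \<Rightarrow> bool"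
where
  "closed_loop_solution E T d x \<longleftrightarrow>
     (\<forall>i. continuous_on {0..} (x i) \<and>
       (\<forall>t>0. (\<forall>j k. t \<noteq> T j k + d j k) \<longrightarrow>
          (x i has_real_derivative broadcast_control E T d x i t) (at t)))"

end

theory Submission
  imports Defs
begin

text \<open>Put \<open>r = h + \<tau>\<close> and \<open>u = - L y\<close>, where \<open>y\<close> is the vector of samples in use. The
  supremum in the hypothesis is at most 1, so \<open>r \<lambda>\<^sub>n < 1\<close>, and this already suffices. The
  Laplacian satisfies \<open>|L z|\<^sup>2 \<le> \<lambda>\<^sub>n z \<bullet> L z\<close>, the samples in use are at most \<open>r\<close> old, and
  therefore the squared sampling error at time \<open>t\<close> is at most \<open>r\<close> times the integral of
  \<open>|u|\<^sup>2\<close> over \<open>[t - r, t]\<close>. Hence \<open>|x|\<^sup>2 / 2\<close> plus \<open>1 / \<lambda>\<^sub>n - r\<close> times the integral of \<open>|u|\<^sup>2\<close>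
  stays bounded: the state is bounded and \<open>|u|\<^sup>2\<close> is integrable. The sampling error then tends
  to 0, and so does \<open>L x\<close>; connectedness turns this into agreement, and the average is conserved
  because the contributions of an edge to its two ends cancel.\<close>

section \<open>Calculus with finitely many exceptional instants\<close>

text \<open>A mean value inequality for functions that may lack a derivative at the update instants.
  With \<open>B = 0\<close> it turns a pointwise dissipation inequality into monotonicity.\<close>

lemma increment_le:
  fixes f f' :: "real \<Rightarrow> real"
  assumes S: "finite (S \<inter> {a..b})" and ab: "a \<le> b" and cont: "continuous_on {a..b} f"
    and deriv: "\<And>t. a < t \<Longrightarrow> t < b \<Longrightarrow> t \<notin> S \<Longrightarrow> (f has_real_derivative f' t) (at t)"
    and le: "\<And>t. a < t \<Longrightarrow> t < b \<Longrightarrow> t \<notin> S \<Longrightarrow> f' t \<le> B"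
  shows "f b - f a \<le> B * (b - a)"
proof -
  \<comment> \<open>The value \<open>B\<close> at the exceptional points leaves the integral
    unchanged and makes \<open>g \<le> B\<close> hold everywhere.\<close>
  define g where "g t = (if t \<in> {a<..<b} - S then f' t else B)" for t
  have "(g has_integral (f b - f a)) {a..b}"
  proof (rule fundamental_theorem_of_calculus_interior_strong[OF S ab _ cont])
    fix t assume "t \<in> {a<..<b} - S \<inter> {a..b}"
    then show "(f has_vector_derivative g t) (at t)"
      using deriv[of t]
      by (auto simp: g_def has_real_derivative_iff_has_vector_derivative)
  qed
  moreover have "((\<lambda>_. B) has_integral B * (b - a)) {a..b}"
    using has_integral_const_real[of B a b] ab by (simp add: mult.commute)
  ultimately show ?thesis
    by (rule has_integral_le) (auto simp: g_def le)
qed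

text \<open>Deleting the exceptional points and the ends leaves a measurable set on which
  \<open>f\<close> is continuous, hence measurable; boundedness then gives integrability.\<close>

lemma integrable_on_bounded_continuous_off_finite:
  fixes f :: "real \<Rightarrow> real"
  assumes S: "finite (S \<inter> {a..b})"
    and bd: "\<And>t. t \<in> {a..b} \<Longrightarrow> \<bar>f t\<bar> \<le> B"
    and cont: "\<And>t. a < t \<Longrightarrow> t < b \<Longrightarrow> t \<notin> S \<Longrightarrow> isCont f t"
  shows "f integrable_on {a..b}"
proof -
  define U where "U = {a..b} - (S \<inter> {a..b} \<union> {a, b})"
  have sets: "U \<in> sets lebesgue"
    unfolding U_def using S
    by (intro sets.Diff sets_completionI_sets) (auto intro!: borel_closed finite_imp_closed)
  have "continuous_on U f"
    by (rule continuous_at_imp_continuous_on) (auto simp: U_def intro!: cont)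
  then have meas: "f \<in> borel_measurable (lebesgue_on U)"
    using sets by (rule continuous_imp_measurable_on_sets_lebesgue)
  have neg: "negligible ((U - {a..b}) \<union> ({a..b} - U))"
    by (rule negligible_subset[of "S \<inter> {a..b} \<union> {a, b}"])
       (use S in \<open>auto simp: U_def intro!: negligible_finite\<close>)
  have const: "(\<lambda>_. B) integrable_on U"
    using integrable_spike_set_eq[OF neg, of "\<lambda>_. B"] integrable_const_ivl[of B a b] by simp
  have "norm (f t) \<le> B" if "t \<in> U" for t
    using that bd[of t] by (simp add: U_def)
  then have "f integrable_on U"
    by (rule measurable_bounded_by_integrable_imp_integrable[OF meas const _ sets])
  then show ?thesis
    using integrable_spike_set_eq[OF neg, of f] by simp
qed

lemma integral_has_real_derivative_at:
  fixes f :: "real \<Rightarrow> real"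
  assumes "f integrable_on {a..b}" "a < t" "t < b" "isCont f t"
  shows "((\<lambda>s. integral {a..s} f) has_real_derivative f t) (at t)"
proof -
  have "((\<lambda>s. integral {a..s} f) has_vector_derivative f t) (at t within ({a..b} - {}))"
    by (rule integral_has_vector_derivative_continuous_at)
       (use assms in \<open>auto intro: continuous_at_imp_continuous_at_within\<close>)
  then show ?thesis
    using assms
    by (simp add: has_real_derivative_iff_has_vector_derivative at_within_Icc_at)
qed

section \<open>Delayed gradient-like flows\<close>

text \<open>\<open>S\<close> is the set of update instants, \<open>xh\<close> the samples in use, \<open>A\<close> the coupling matrix and
  \<open>lam\<close> a cocoercivity constant of \<open>A\<close>.\<close>

locale delayed_flow =
  fixes S :: "real set" and x xh :: "'n::finite \<Rightarrow> real \<Rightarrow> real" and A :: "'n \<Rightarrow> 'n \<Rightarrow> real"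
    and r lam t0 :: real
  assumes finite_S: "finite (S \<inter> {a..b})"
    and r_pos: "r > 0" and lam_pos: "lam > 0" and r_lam: "r * lam < 1" and t0_nonneg: "t0 \<ge> 0"
    and coer: "(\<Sum>i\<in>UNIV. (\<Sum>j\<in>UNIV. A i j * z j)\<^sup>2) \<le> lam * (\<Sum>i\<in>UNIV. z i * (\<Sum>j\<in>UNIV. A i j * z j))"
    and cont_x: "continuous_on {0..} (x i)"
    and deriv_x: "t > t0 \<Longrightarrow> t \<notin> S \<Longrightarrow>
      (x i has_real_derivative - (\<Sum>j\<in>UNIV. A i j * xh j t)) (at t)"
    and cont_xh: "t > t0 \<Longrightarrow> t \<notin> S \<Longrightarrow> isCont (xh i) t"
    and delayed: "t \<ge> t0 \<Longrightarrow> \<exists>s\<ge>0. t - r \<le> s \<and> s \<le> t \<and> xh i t = x i s"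
begin

definition u :: "'n \<Rightarrow> real \<Rightarrow> real" where
  "u i t = - (\<Sum>j\<in>UNIV. A i j * xh j t)"

text \<open>The control energy that agent \<open>i\<close> has spent since
  \<open>t0\<close>.\<close>

definition F :: "'n \<Rightarrow> real \<Rightarrow> real" where
  "F i t = integral {t0..t} (\<lambda>s. (u i s)\<^sup>2)"

lemma x_deriv: "t > t0 \<Longrightarrow> t \<notin> S \<Longrightarrow> (x i has_real_derivative u i t) (at t)"
  using deriv_x by (simp add: u_def)

lemma x_cont: "t0 \<le> a \<Longrightarrow> continuous_on {a..b} (x i)"
  using cont_x by (rule continuous_on_subset) (use t0_nonneg in auto)

lemma xh_bounded: obtains B where "\<And>i t. t \<in> {t0..b} \<Longrightarrow> \<bar>xh i t\<bar> \<le> B"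
proof -
  \<comment> \<open>Samples in use after \<open>t0\<close> may have been taken before it, so the
    bound has to cover all of \<open>{0..b}\<close>.\<close>
  have "\<exists>B. \<forall>t\<in>{0..b}. \<bar>x i t\<bar> \<le> B" for i
  proof -
    have "bounded (x i ` {0..b})"
      by (intro compact_imp_bounded compact_continuous_image continuous_on_subset[OF cont_x]) auto
    then show ?thesis by (auto simp: bounded_iff)
  qed
  then obtain B where B: "\<And>i t. t \<in> {0..b} \<Longrightarrow> \<bar>x i t\<bar> \<le> B i"
    by metis
  have "\<bar>xh i t\<bar> \<le> Max (range B)" if t: "t \<in> {t0..b}" for i t
  proof -
    obtain s where s: "s \<ge> 0" "s \<le> t" "xh i t = x i s"
      using delayed[of t i] t by auto
    have "\<bar>xh i t\<bar> \<le> B i" using s B[of s i] t by auto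
    also have "B i \<le> Max (range B)" by (intro Max_ge) auto
    finally show ?thesis .
  qed
  then show ?thesis using that by blast
qed

lemma u_sq_integrable: "(\<lambda>s. (u i s)\<^sup>2) integrable_on {t0..b}"
proof -
  obtain B where B: "\<And>i t. t \<in> {t0..b} \<Longrightarrow> \<bar>xh i t\<bar> \<le> B" using xh_bounded by blast
  have "\<bar>(u i t)\<^sup>2\<bar> \<le> (\<Sum>j\<in>UNIV. \<bar>A i j\<bar> * B)\<^sup>2" if "t \<in> {t0..b}" for t
  proof -
    have "\<bar>u i t\<bar> \<le> (\<Sum>j\<in>UNIV. \<bar>A i j * xh j t\<bar>)"
      unfolding u_def by (simp add: sum_abs)
    also have "\<dots> \<le> (\<Sum>j\<in>UNIV. \<bar>A i j\<bar> * B)"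
      using B[OF that] by (intro sum_mono) (simp add: abs_mult mult_left_mono)
    finally have "\<bar>u i t\<bar>\<^sup>2 \<le> (\<Sum>j\<in>UNIV. \<bar>A i j\<bar> * B)\<^sup>2"
      by (intro power_mono) auto
    then show ?thesis by simp
  qed
  moreover have "isCont (\<lambda>s. (u i s)\<^sup>2) t" if "t > t0" "t \<notin> S" for t
    unfolding u_def using cont_xh[OF that] by (intro continuous_intros) auto
  ultimately show ?thesis
    by (intro integrable_on_bounded_continuous_off_finite[OF finite_S])
qed

lemma F_cont: "t0 \<le> a \<Longrightarrow> continuous_on {a..b} (F i)"
  using indefinite_integral_continuous_1[OF u_sq_integrable[of i b]]
  unfolding F_def by (rule continuous_on_subset) auto

lemma F_deriv:
  assumes "t > t0" "t \<notin> S"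
  shows "(F i has_real_derivative (u i t)\<^sup>2) (at t)"
  unfolding F_def
proof (rule integral_has_real_derivative_at[OF u_sq_integrable[of i "t + 1"]])
  show "isCont (\<lambda>s. (u i s)\<^sup>2) t"
    unfolding u_def using cont_xh[OF assms] by (intro continuous_intros) auto
qed (use assms in auto)

lemma F_mono:
  assumes "t0 \<le> a" "a \<le> b"
  shows "F i a \<le> F i b"
proof -
  have "- F i b - - F i a \<le> 0 * (b - a)"
  proof (rule increment_le[OF finite_S assms(2), where f = "\<lambda>t. - F i t" and f' = "\<lambda>t. - (u i t)\<^sup>2"])
    show "continuous_on {a..b} (\<lambda>t. - F i t)"
      by (intro continuous_on_minus F_cont assms)
    show "((\<lambda>t. - F i t) has_real_derivative - (u i t)\<^sup>2) (at t)" if "a < t" "t \<notin> S" for t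
      using that assms by (intro DERIV_minus F_deriv) auto
  qed auto
  then show ?thesis by simp
qed

text \<open>Integrating \<open>(u i s - c)\<^sup>2 \<ge> 0\<close> with \<open>c = (x i b - x i a) / q\<close>.\<close>

lemma increment_sq_le:
  assumes "t0 \<le> a" "a \<le> b" "b - a \<le> q" "q > 0"
  shows "(x i b - x i a)\<^sup>2 \<le> q * (F i b - F i a)"
proof -
  define \<Delta> where "\<Delta> = x i b - x i a"
  \<comment> \<open>Dividing by \<open>q\<close> instead of \<open>b - a\<close> covers
    \<open>a = b\<close> without a case split.\<close>
  define c where "c = \<Delta> / q"
  define g where "g t = 2 * c * x i t - c\<^sup>2 * t - F i t" for t
  have "g b - g a \<le> 0 * (b - a)"
  proof (rule increment_le[OF finite_S assms(2), where f = g and f' = "\<lambda>t. - (u i t - c)\<^sup>2"])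
    show "continuous_on {a..b} g"
      unfolding g_def using assms by (intro continuous_intros x_cont F_cont)
    show "(g has_real_derivative - (u i t - c)\<^sup>2) (at t)" if "a < t" "t \<notin> S" for t
    proof -
      have "(g has_real_derivative 2 * c * u i t - c\<^sup>2 * 1 - (u i t)\<^sup>2) (at t)"
        unfolding g_def using that assms
        by (intro DERIV_diff DERIV_cmult DERIV_ident x_deriv F_deriv) auto
      then show ?thesis by (simp add: power2_eq_square algebra_simps)
    qed
  qed auto
  then have "2 * c * \<Delta> - c\<^sup>2 * (b - a) \<le> F i b - F i a"
    unfolding g_def \<Delta>_def by (simp add: algebra_simps)
  moreover have "c\<^sup>2 * (b - a) \<le> c\<^sup>2 * q"
    using assms by (intro mult_left_mono) auto
  ultimately have "2 * c * \<Delta> - c\<^sup>2 * q \<le> F i b - F i a" by linarith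
  then have "q * (2 * c * \<Delta> - c\<^sup>2 * q) \<le> q * (F i b - F i a)"
    using assms by (intro mult_left_mono) auto
  moreover have "q * (2 * c * \<Delta> - c\<^sup>2 * q) = \<Delta>\<^sup>2"
    unfolding c_def using assms by (simp add: field_simps power2_eq_square)
  ultimately show ?thesis by (simp add: \<Delta>_def)
qed

text \<open>The sample in use is a value of \<open>x i\<close> at most \<open>r\<close> ago, so the
  error is an increment of the state. From \<open>t0 + r\<close> on, the whole window of length
  \<open>r\<close> lies after \<open>t0\<close>, where \<open>F\<close> measures the
  velocity.\<close>

lemma sampling_error_sq_le:
  assumes "t \<ge> t0 + r"
  shows "(xh i t - x i t)\<^sup>2 \<le> r * (F i t - F i (t - r))"
proof -
  obtain s where s: "t - r \<le> s" "s \<le> t" "xh i t = x i s"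
    using delayed[of t i] assms r_pos by auto
  have "(x i t - x i s)\<^sup>2 \<le> r * (F i t - F i s)"
    using s assms r_pos by (intro increment_sq_le) auto
  also have "\<dots> \<le> r * (F i t - F i (t - r))"
    using s assms r_pos F_mono[of "t - r" s i] by (intro mult_left_mono) auto
  finally show ?thesis using s by (simp add: power2_commute)
qed

section \<open>Energy estimate by a Lyapunov--Krasovskii functional\<close>

definition FF :: "real \<Rightarrow> real" where "FF t = (\<Sum>i\<in>UNIV. F i t)"

text \<open>A second antiderivative of \<open>|u|\<^sup>2\<close>. The integral of
  \<open>FF t - FF s\<close> over \<open>s\<close> in the delay window equals
  \<open>r * FF t - (G t - G (t - r))\<close>, which is easy to differentiate.\<close>

definition G :: "real \<Rightarrow> real" where "G t = integral {t0..t} FF"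

lemma FF_cont: "t0 \<le> a \<Longrightarrow> continuous_on {a..b} FF"
  unfolding FF_def by (intro continuous_intros F_cont)

lemma FF_mono: "t0 \<le> a \<Longrightarrow> a \<le> b \<Longrightarrow> FF a \<le> FF b"
  unfolding FF_def by (intro sum_mono F_mono)

lemma FF_nonneg: "t0 \<le> t \<Longrightarrow> 0 \<le> FF t"
  using FF_mono[of t0 t] by (simp add: FF_def F_def)

lemma G_cont: "t0 \<le> a \<Longrightarrow> continuous_on {a..b} G"
  using indefinite_integral_continuous_1[OF integrable_continuous_real[OF FF_cont[of t0 b, OF order_refl]]]
  unfolding G_def by (rule continuous_on_subset) auto

lemma G_deriv:
  assumes "t > t0"
  shows "(G has_real_derivative FF t) (at t)"
  unfolding G_def
proof (rule integral_has_real_derivative_at[OF integrable_continuous_real[OF FF_cont[of t0 "t + 1", OF order_refl]]])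
  show "isCont FF t"
    using FF_cont[of t0 "t + 1", OF order_refl] by (rule continuous_on_interior) (use assms in auto)
qed (use assms in auto)

text \<open>With \<open>e = xh - x\<close>, the product \<open>x u\<close> splits into
  \<open>xh u\<close>, controlled by cocoercivity, and \<open>- e u\<close>, controlled by Young's
  inequality and the sampling error bound. The left-hand side is the derivative of the functional
  \<open>W\<close> used next.\<close>

lemma dissipation:
  assumes t: "t \<ge> t0 + r"
  shows "(\<Sum>i\<in>UNIV. x i t * u i t) + (1 / lam - r / 2) * (\<Sum>i\<in>UNIV. (u i t)\<^sup>2)
           - (FF t - FF (t - r)) / 2 \<le> 0"
proof -
  have "(\<Sum>i\<in>UNIV. (u i t)\<^sup>2) \<le> lam * - (\<Sum>i\<in>UNIV. xh i t * u i t)"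
    using coer[of "\<lambda>j. xh j t"] by (simp add: u_def sum_negf)
  then have "(\<Sum>i\<in>UNIV. xh i t * u i t) \<le> - (1 / lam) * (\<Sum>i\<in>UNIV. (u i t)\<^sup>2)"
    using lam_pos by (simp add: field_simps)
  moreover have "- ((xh i t - x i t) * u i t) \<le> r / 2 * (u i t)\<^sup>2 + (F i t - F i (t - r)) / 2" for i
  proof -
    define e w where "e = xh i t - x i t" and "w = u i t"
    \<comment> \<open>Young's inequality with weight \<open>r\<close>, which matches the factor
      \<open>r\<close> in the bound on the squared error.\<close>
    have "0 \<le> (e + r * w)\<^sup>2" by simp
    then have "r * (- 2 * e * w) \<le> e\<^sup>2 + r\<^sup>2 * w\<^sup>2"
      by (simp add: power2_eq_square algebra_simps)
    also have "\<dots> \<le> r * (F i t - F i (t - r) + r * w\<^sup>2)"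
      using sampling_error_sq_le[OF t, of i]
      by (simp add: e_def algebra_simps power2_eq_square)
    finally have "- 2 * e * w \<le> F i t - F i (t - r) + r * w\<^sup>2"
      using r_pos by (simp only: mult_le_cancel_left_pos)
    then show ?thesis unfolding e_def w_def by (simp add: field_simps)
  qed
  then have "(\<Sum>i\<in>UNIV. - ((xh i t - x i t) * u i t)) \<le>
      (\<Sum>i\<in>UNIV. r / 2 * (u i t)\<^sup>2 + (F i t - F i (t - r)) / 2)"
    by (intro sum_mono)
  moreover have "(\<Sum>i\<in>UNIV. - ((xh i t - x i t) * u i t)) =
      (\<Sum>i\<in>UNIV. x i t * u i t) - (\<Sum>i\<in>UNIV. xh i t * u i t)"
    by (simp add: left_diff_distrib sum_subtractf)
  moreover have "(\<Sum>i\<in>UNIV. r / 2 * (u i t)\<^sup>2 + (F i t - F i (t - r)) / 2) =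
      r / 2 * (\<Sum>i\<in>UNIV. (u i t)\<^sup>2) + (FF t - FF (t - r)) / 2"
    unfolding FF_def by (simp only: sum.distrib sum_subtractf flip: sum_distrib_left sum_divide_distrib)
  ultimately show ?thesis
    unfolding left_diff_distrib by linarith
qed

text \<open>By dissipation \<open>W\<close> does not increase, and it dominates half the squared
  state plus \<open>1 / lam - r\<close> times the energy spent; this weight is positive because
  \<open>r * lam < 1\<close>.\<close>

lemma energy_bounded:
  obtains C where "\<And>t. t \<ge> t0 + r \<Longrightarrow> (\<Sum>i\<in>UNIV. (x i t)\<^sup>2) \<le> C"
    and "\<And>t. t \<ge> t0 + r \<Longrightarrow> FF t \<le> C"
proof -
  define t1 where "t1 = t0 + r"
  define V where "V t = (\<Sum>i\<in>UNIV. (x i t)\<^sup>2)" for t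
  \<comment> \<open>Lyapunov--Krasovskii functional: the derivative of \<open>G t - G (t - r)\<close> is the energy spent in
    the window that controls the sampling error.\<close>
  define W where "W t = V t / 2 + (1 / lam - r / 2) * FF t
     - (G t - G (t - r)) / 2" for t
  define \<delta> where "\<delta> = 1 / lam - r"
  have \<delta>: "\<delta> > 0" unfolding \<delta>_def using r_lam lam_pos by (simp add: field_simps)
  have bound: "V t / 2 + \<delta> * FF t \<le> W t1" if t: "t \<ge> t1" for t
  proof -
    have "W t - W t1 \<le> 0 * (t - t1)"
    proof (rule increment_le[OF finite_S t, where f = W and f' = "\<lambda>t. (\<Sum>i\<in>UNIV. x i t * u i t)
           + (1 / lam - r / 2) * (\<Sum>i\<in>UNIV. (u i t)\<^sup>2) - (FF t - FF (t - r)) / 2"])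
      have "continuous_on {t1..t} (\<lambda>s. G (s - r))"
        by (rule continuous_on_compose2[OF G_cont[of t0 t]])
           (use r_pos in \<open>auto intro!: continuous_intros simp: t1_def\<close>)
      then show "continuous_on {t1..t} W"
        unfolding W_def V_def using r_pos
        by (intro continuous_intros x_cont FF_cont G_cont) (auto simp: t1_def)
      fix s assume s: "t1 < s" "s \<notin> S"
      then have s': "s > t0" "s - r > t0" using r_pos by (auto simp: t1_def)
      have "((\<lambda>s. G (s - r)) has_real_derivative FF (s - r) * 1) (at s)"
        using s' by (intro DERIV_chain2[OF G_deriv]) (auto intro!: derivative_eq_intros)
      moreover have "(FF has_real_derivative (\<Sum>i\<in>UNIV. (u i s)\<^sup>2)) (at s)"
        unfolding FF_def using s s' by (auto intro!: derivative_eq_intros F_deriv)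
      moreover have "(V has_real_derivative 2 * (\<Sum>i\<in>UNIV. x i s * u i s)) (at s)"
        unfolding V_def using s s' by (auto intro!: derivative_eq_intros x_deriv simp: sum_distrib_left mult_ac)
      ultimately show "(W has_real_derivative (\<Sum>i\<in>UNIV. x i s * u i s)
           + (1 / lam - r / 2) * (\<Sum>i\<in>UNIV. (u i s)\<^sup>2) - (FF s - FF (s - r)) / 2) (at s)"
        unfolding W_def using s' G_deriv[of s]
        by (auto intro!: derivative_eq_intros simp: diff_divide_distrib)
      show "(\<Sum>i\<in>UNIV. x i s * u i s) + (1 / lam - r / 2) * (\<Sum>i\<in>UNIV. (u i s)\<^sup>2)
           - (FF s - FF (s - r)) / 2 \<le> 0"
        using s by (intro dissipation) (simp add: t1_def)
    qed
    then have "W t \<le> W t1" by simp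
    \<comment> \<open>As \<open>FF\<close> is nondecreasing, its integral over the window is at most
      \<open>r * FF t\<close>; this lowers the coefficient \<open>1 / lam - r / 2\<close> to
      \<open>\<delta>\<close>.\<close>
    moreover have "G t - G (t - r) \<le> FF t * (t - (t - r))"
      by (rule increment_le[where S = "{}" and f = G and f' = FF])
         (use t r_pos in \<open>auto simp: t1_def intro!: G_cont G_deriv FF_mono\<close>)
    then have "G t - G (t - r) \<le> FF t * r" by simp
    moreover have "\<delta> * FF t = (1 / lam - r / 2) * FF t - FF t * r / 2"
      unfolding \<delta>_def by (simp add: algebra_simps)
    ultimately show ?thesis
      unfolding W_def[of t] by argo
  qed
  define C where "C = max (2 * W t1) (W t1 / \<delta>)"
  show ?thesis
  proof (rule that[of C])
    fix t assume t: "t \<ge> t0 + r"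
    then have "FF t \<ge> 0" using r_pos by (intro FF_nonneg) auto
    then have "\<delta> * FF t \<ge> 0" using \<delta> by simp
    then have "V t / 2 \<le> W t1" using bound[of t] t unfolding t1_def by linarith
    then show "(\<Sum>i\<in>UNIV. (x i t)\<^sup>2) \<le> C" unfolding C_def V_def by linarith
    have "V t \<ge> 0" unfolding V_def by (intro sum_nonneg) auto
    then have "\<delta> * FF t \<le> W t1" using bound[of t] t by (auto simp: t1_def)
    then have "FF t \<le> W t1 / \<delta>" using \<delta> by (simp add: field_simps)
    then show "FF t \<le> C" unfolding C_def by linarith
  qed
qed

text \<open>Bounded and monotone, \<open>FF\<close> comes within \<open>\<epsilon>\<close> of its
  supremum at some \<open>M\<close>. No single \<open>F i\<close> grows more than the sum, because
  every summand is monotone.\<close>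

lemma FF_Cauchy:
  assumes "\<epsilon> > 0"
  obtains M where "M \<ge> t0 + r" "\<And>i a b. M \<le> a \<Longrightarrow> a \<le> b \<Longrightarrow> F i b - F i a < \<epsilon>"
proof -
  obtain C where C: "\<And>t. t \<ge> t0 + r \<Longrightarrow> FF t \<le> C" using energy_bounded by metis
  define s where "s = Sup (FF ` {t0 + r..})"
  have bdd: "bdd_above (FF ` {t0 + r..})" using C by (auto simp: bdd_above_def)
  obtain M where M: "M \<ge> t0 + r" "FF M > s - \<epsilon>"
    using less_cSup_iff[of "FF ` {t0 + r..}" "s - \<epsilon>"] bdd assms unfolding s_def by auto
  have "F i b - F i a < \<epsilon>" if ab: "M \<le> a" "a \<le> b" for i a b
  proof -
    have t0: "t0 \<le> M" using M r_pos by linarith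
    have "F i b - F i a \<le> (\<Sum>i\<in>UNIV. F i b - F i a)"
      using ab t0 by (intro member_le_sum[of i UNIV "\<lambda>i. F i b - F i a"]) (auto intro: F_mono)
    also have "\<dots> = FF b - FF a" by (simp add: FF_def sum_subtractf)
    also have "\<dots> \<le> FF b - FF M" using FF_mono[of M a] t0 ab by auto
    also have "FF b \<le> s" unfolding s_def using bdd M ab by (intro cSup_upper) auto
    finally show ?thesis using M by linarith
  qed
  then show ?thesis using M that by blast
qed

text \<open>Over a unit time step \<open>x\<close> and \<open>xh\<close> hardly change, so the velocity is almost the constant
  \<open>- A x(t)\<close>; but the total displacement is small as well.\<close>

lemma coupling_tendsto_0: "((\<lambda>t. \<Sum>j\<in>UNIV. A i j * x j t) \<longlongrightarrow> 0) at_top"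
proof (rule tendstoI)
  fix \<epsilon> :: real assume \<epsilon>: "\<epsilon> > 0"
  define K where "K = (\<Sum>j\<in>UNIV. \<bar>A i j\<bar>)"
  \<comment> \<open>Leaves room for the final bound \<open>\<delta> * (2 * K + 1)\<close>.\<close>
  define \<delta> where "\<delta> = \<epsilon> / (2 * K + 2)"
  have K: "K \<ge> 0" unfolding K_def by (intro sum_nonneg) auto
  have \<delta>: "\<delta> > 0" unfolding \<delta>_def using K \<epsilon> by simp
  \<comment> \<open>A window of length \<open>q\<close> accommodates both the unit time step and the
    age of any sample.\<close>
  define q where "q = max 1 r"
  have q: "q \<ge> 1" "q \<ge> r" unfolding q_def by auto
  obtain M where M: "M \<ge> t0 + r" "\<And>i a b. M \<le> a \<Longrightarrow> a \<le> b \<Longrightarrow> F i b - F i a < \<delta>\<^sup>2 / q"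
    using FF_Cauchy[of "\<delta>\<^sup>2 / q"] \<delta> q by auto
  have close: "\<bar>x j b - x j a\<bar> < \<delta>" if "M \<le> a" "a \<le> b" "b - a \<le> q" for j a b
  proof -
    have "(x j b - x j a)\<^sup>2 \<le> q * (F j b - F j a)"
      using that M(1) q r_pos by (intro increment_sq_le) auto
    also have "\<dots> < q * (\<delta>\<^sup>2 / q)" using M(2)[OF that(1,2)] q by (intro mult_strict_left_mono) auto
    finally have "\<bar>x j b - x j a\<bar>\<^sup>2 < \<delta>\<^sup>2" using q by simp
    then show ?thesis by (rule power2_less_imp_less) (use \<delta> in simp)
  qed
  \<comment> \<open>The extra \<open>r\<close> ensures that the samples in use after
    \<open>t\<close> were taken no earlier than \<open>M\<close>.\<close>
  have "\<bar>\<Sum>j\<in>UNIV. A i j * x j t\<bar> < \<epsilon>" if t: "t \<ge> M + r" for t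
  proof -
    define a where "a = (\<Sum>j\<in>UNIV. A i j * x j t)"
    have speed: "\<bar>u i s + a\<bar> \<le> K * (2 * \<delta>)" if s: "t < s" "s < t + 1" for s
    proof -
      have "\<bar>x j t - xh j s\<bar> \<le> 2 * \<delta>" for j
      proof -
        obtain w where w: "s - r \<le> w" "w \<le> s" "xh j s = x j w"
          using delayed[of s j] s t M(1) r_pos by auto
        have "\<bar>x j s - x j w\<bar> < \<delta>" using w s t q r_pos by (intro close) auto
        moreover have "\<bar>x j s - x j t\<bar> < \<delta>" using s t q r_pos by (intro close) auto
        ultimately show ?thesis using w by linarith
      qed
      then have "(\<Sum>j\<in>UNIV. \<bar>A i j\<bar> * \<bar>x j t - xh j s\<bar>) \<le> K * (2 * \<delta>)"
        unfolding K_def sum_distrib_right by (intro sum_mono mult_left_mono) auto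
      moreover have "u i s + a = (\<Sum>j\<in>UNIV. A i j * (x j t - xh j s))"
        unfolding u_def a_def by (simp add: right_diff_distrib sum_subtractf)
      moreover have "\<bar>\<Sum>j\<in>UNIV. A i j * (x j t - xh j s)\<bar> \<le> (\<Sum>j\<in>UNIV. \<bar>A i j\<bar> * \<bar>x j t - xh j s\<bar>)"
        using sum_abs[of "\<lambda>j. A i j * (x j t - xh j s)" UNIV] by (simp add: abs_mult)
      ultimately show ?thesis by linarith
    qed
    have t0: "t0 \<le> t" using t M(1) r_pos by linarith
    \<comment> \<open>Adding \<open>s * a\<close> removes the nominal velocity \<open>- a\<close>,
      so that only the small remainder \<open>u i s + a\<close> is left to integrate.\<close>
    have cont: "continuous_on {t..t + 1} (\<lambda>s. x i s + s * a)"
      by (intro continuous_intros x_cont t0)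
    have deriv: "((\<lambda>s. x i s + s * a) has_real_derivative u i s + a) (at s)" if "t < s" "s \<notin> S" for s
    proof -
      have "((\<lambda>s. x i s + s * a) has_real_derivative u i s + 1 * a) (at s)"
        using that t0 by (intro DERIV_add DERIV_cmult_right DERIV_ident x_deriv) auto
      then show ?thesis by simp
    qed
    have up: "(x i (t + 1) + (t + 1) * a) - (x i t + t * a) \<le> K * (2 * \<delta>) * (t + 1 - t)"
      by (rule increment_le[OF finite_S _ cont deriv]) (use speed in \<open>auto simp: abs_le_iff\<close>)
    have lo: "- (x i (t + 1) + (t + 1) * a) - - (x i t + t * a) \<le> K * (2 * \<delta>) * (t + 1 - t)"
      by (rule increment_le[OF finite_S _ continuous_on_minus[OF cont] DERIV_minus[OF deriv]])
         (use speed in \<open>auto simp: abs_le_iff\<close>)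
    have sm: "\<bar>x i (t + 1) - x i t\<bar> < \<delta>" using t q r_pos by (intro close) auto
    have "x i (t + 1) - x i t + a \<le> K * (2 * \<delta>)" "- (x i (t + 1) - x i t + a) \<le> K * (2 * \<delta>)"
      using up lo by (simp_all add: algebra_simps)
    then have "\<bar>a\<bar> < K * (2 * \<delta>) + \<delta>" using sm by linarith
    also have "\<dots> = \<delta> * (2 * K + 1)" by (simp add: algebra_simps)
    also have "\<dots> < \<delta> * (2 * K + 2)" using \<delta> by (intro mult_strict_left_mono) auto
    also have "\<dots> = \<epsilon>" unfolding \<delta>_def using K by simp
    finally show ?thesis unfolding a_def .
  qed
  then show "\<forall>\<^sub>F t in at_top. dist (\<Sum>j\<in>UNIV. A i j * x j t) 0 < \<epsilon>"
    unfolding dist_real_def by (intro eventually_at_top_linorderI[of "M + r"]) simp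
qed

end

section \<open>Spectral bounds for the Laplacian\<close>

lemma symmetric_matrix_inner:
  fixes A :: "real^'n^'n"
  assumes "transpose A = A"
  shows "x \<bullet> (A *v y) = (A *v x) \<bullet> y"
  using assms by (metis dot_lmul_matrix transpose_matrix_vector)

text \<open>The quadratic form attains its maximum on the compact unit sphere. At a maximiser
  \<open>v\<close> the residual \<open>w = \<mu> v - A v\<close> vanishes, since otherwise a small
  step from \<open>v\<close> along \<open>- w\<close> would violate the bound.\<close>

lemma symmetric_max_eigenvalue:
  fixes A :: "real^'n^'n"
  assumes sym: "transpose A = A"
  obtains \<mu> v where "v \<noteq> 0" "A *v v = \<mu> *\<^sub>R v" "\<And>x. x \<bullet> (A *v x) \<le> \<mu> * (x \<bullet> x)"
proof -
  let ?q = "\<lambda>x. x \<bullet> (A *v x)"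
  have "continuous_on (sphere 0 1) ?q"
    by (intro continuous_intros linear_continuous_on matrix_vector_mul_bounded_linear)
  moreover have "sphere (0::real^'n) 1 \<noteq> {}" by simp
  ultimately obtain v where v: "norm v = 1" and vmax: "\<And>x. norm x = 1 \<Longrightarrow> ?q x \<le> ?q v"
    using continuous_attains_sup[OF compact_sphere, of 0 1 ?q] by auto
  define \<mu> where "\<mu> = ?q v"
  have bound: "?q x \<le> \<mu> * (x \<bullet> x)" for x
  proof (cases "x = 0")
    case False
    have "?q (x /\<^sub>R norm x) \<le> \<mu>"
      unfolding \<mu>_def using False by (intro vmax) simp
    then have "?q x / (norm x)\<^sup>2 \<le> \<mu>"
      by (simp add: matrix_vector_mult_scaleR power2_eq_square divide_inverse mult_ac)
    then show ?thesis
      using False by (simp add: field_simps power2_norm_eq_inner)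
  qed simp
  define w where "w = \<mu> *\<^sub>R v - A *v v"
  define b where "b = \<mu> * (w \<bullet> w) - ?q w"
  have b: "b \<ge> 0" unfolding b_def using bound[of w] by simp
  have vv: "v \<bullet> v = 1" using v by (simp add: norm_eq_1)
  have quad: "0 \<le> - 2 * t * (w \<bullet> w) + t\<^sup>2 * b" for t
  proof -
    have "?q (v - t *\<^sub>R w) = \<mu> - 2 * t * (w \<bullet> (A *v v)) + t\<^sup>2 * ?q w"
      using symmetric_matrix_inner[OF sym, of v w]
      by (simp add: \<mu>_def matrix_vector_mult_diff_distrib matrix_vector_mult_scaleR
          inner_diff_left inner_diff_right inner_commute power2_eq_square algebra_simps)
    moreover have "(v - t *\<^sub>R w) \<bullet> (v - t *\<^sub>R w) = 1 - 2 * t * (w \<bullet> v) + t\<^sup>2 * (w \<bullet> w)"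
      by (simp add: vv inner_diff_left inner_diff_right inner_commute power2_eq_square algebra_simps)
    moreover have "w \<bullet> w = \<mu> * (w \<bullet> v) - w \<bullet> (A *v v)"
      by (subst (2) w_def) (simp add: inner_diff_right)
    then have "2 * t * (w \<bullet> w) = 2 * t * \<mu> * (w \<bullet> v) - 2 * t * (w \<bullet> (A *v v))"
      by (simp add: right_diff_distrib)
    ultimately have "?q (v - t *\<^sub>R w) - \<mu> * ((v - t *\<^sub>R w) \<bullet> (v - t *\<^sub>R w)) = 2 * t * (w \<bullet> w) - t\<^sup>2 * b"
      by (simp add: b_def right_diff_distrib distrib_left mult.left_commute)
    then show ?thesis
      using bound[of "v - t *\<^sub>R w"] by linarith
  qed
  have "w \<bullet> w = 0"
  proof (rule ccontr)
    assume "w \<bullet> w \<noteq> 0"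
    then have pos: "w \<bullet> w > 0" by simp
    \<comment> \<open>Small enough for the linear term to dominate the quadratic one; the
      \<open>+ 1\<close> guards against \<open>b = 0\<close>.\<close>
    define t where "t = (w \<bullet> w) / (b + 1)"
    have t: "t > 0" unfolding t_def using pos b by simp
    have "t * b \<le> w \<bullet> w" unfolding t_def using pos b by (simp add: field_simps)
    then have "t * (t * b) \<le> t * (w \<bullet> w)" using t by (intro mult_left_mono) auto
    then have "t * (w \<bullet> w) \<le> 0" using quad[of t] by (simp add: power2_eq_square algebra_simps)
    then show False using mult_pos_pos[OF t pos] by linarith
  qed
  then have "A *v v = \<mu> *\<^sub>R v" by (simp add: w_def)
  then show ?thesis using that[of v \<mu>] bound v by force
qed

lemma det_mat_minus_eq_0_iff:
  fixes A :: "real^'n^'n"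
  shows "det (mat z - A) = 0 \<longleftrightarrow> (\<exists>v. v \<noteq> 0 \<and> A *v v = z *\<^sub>R v)"
proof -
  have "mat z *v v = z *\<^sub>R v" for v :: "real^'n"
    by (simp add: vec_eq_iff matrix_vector_mult_def mat_def if_distrib[of "\<lambda>u. u * _"] cong: if_cong)
  then have ker: "(mat z - A) *v v = 0 \<longleftrightarrow> A *v v = z *\<^sub>R v" for v
    by (auto simp: matrix_vector_mult_diff_rdistrib)
  have "det (mat z - A) = 0 \<longleftrightarrow> \<not> invertible (mat z - A)"
    by (simp add: invertible_det_nz)
  also have "\<dots> \<longleftrightarrow> (\<exists>v. v \<noteq> 0 \<and> (mat z - A) *v v = 0)"
    unfolding invertible_left_inverse matrix_left_invertible_ker by blast
  finally show ?thesis using ker by simp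
qed

lemma ordered_eigenvalues_eigenvector:
  fixes A :: "real^'n^'n"
  assumes "ordered_eigenvalues A lam" "k \<in> {1..CARD('n)}"
  obtains v where "v \<noteq> 0" "A *v v = lam k *\<^sub>R v"
proof -
  have "det (mat (lam k) - A) = (\<Prod>l = 1..CARD('n). (lam k - lam l))"
    using assms by (simp add: ordered_eigenvalues_def)
  also have "\<dots> = 0" using assms(2) by (intro prod_zero) auto
  finally show ?thesis using that det_mat_minus_eq_0_iff by blast
qed

text \<open>The maximum of the form on the unit sphere is itself an eigenvalue, so it occurs in the
  list, whose last entry is the largest.\<close>

lemma ordered_eigenvalues_quadratic_bound:
  fixes A :: "real^'n^'n"
  assumes sym: "transpose A = A" and lam: "ordered_eigenvalues A lam"
  shows "x \<bullet> (A *v x) \<le> lam CARD('n) * (x \<bullet> x)"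
proof -
  obtain \<mu> v where v: "v \<noteq> 0" "A *v v = \<mu> *\<^sub>R v" and bound: "x \<bullet> (A *v x) \<le> \<mu> * (x \<bullet> x)"
    using symmetric_max_eigenvalue[OF sym] by metis
  have "(\<Prod>k = 1..CARD('n). (\<mu> - lam k)) = 0"
    using v lam det_mat_minus_eq_0_iff[of \<mu> A] by (auto simp: ordered_eigenvalues_def)
  then obtain k where k: "k \<in> {1..CARD('n)}" "\<mu> = lam k" by auto
  have "lam k \<le> lam CARD('n)"
    using lam k by (auto simp: ordered_eigenvalues_def intro: mono_onD)
  then have "\<mu> * (x \<bullet> x) \<le> lam CARD('n) * (x \<bullet> x)"
    using k by (intro mult_right_mono) auto
  then show ?thesis using bound by linarith
qed

section \<open>The Laplacian as a sum over edges\<close>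

lemma laplacian_apply:
  "(\<Sum>j\<in>UNIV. laplacian E D $ i $ j * z j) = (\<Sum>e\<in>E. D i e * (\<Sum>j\<in>UNIV. D j e * z j))"
  by (subst sum_distrib_left) (simp add: laplacian_def sum_distrib_right sum.swap[of _ E] mult.assoc)

text \<open>Factoring through the edges makes the form an inner product of
  \<open>D\<^sup>T y\<close> and \<open>D\<^sup>T z\<close>; semidefiniteness and the
  Cauchy--Schwarz argument both rest on this.\<close>

lemma laplacian_bilinear:
  "(\<Sum>i\<in>UNIV. y i * (\<Sum>j\<in>UNIV. laplacian E D $ i $ j * z j))
     = (\<Sum>e\<in>E. (\<Sum>i\<in>UNIV. D i e * y i) * (\<Sum>j\<in>UNIV. D j e * z j))"
  unfolding laplacian_apply
  by (simp add: sum_distrib_left[of "y _"] sum.swap[of _ E] sum_distrib_right[of _ _ "sum _ _"] mult_ac)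

lemma transpose_laplacian: "transpose (laplacian E D) = laplacian E D"
  by (simp add: laplacian_def transpose_def vec_eq_iff mult.commute)

lemma laplacian_quadratic:
  "x \<bullet> (laplacian E D *v x) = (\<Sum>e\<in>E. (\<Sum>j\<in>UNIV. D j e * x $ j)\<^sup>2)"
  using laplacian_bilinear[of "\<lambda>i. x $ i" E D "\<lambda>i. x $ i"]
  by (simp add: inner_vec_def matrix_vector_mult_def power2_eq_square)

lemma laplacian_eigenvalue_nonneg:
  fixes E :: "'n::finite set set"
  assumes "ordered_eigenvalues (laplacian E D) lam" "k \<in> {1..CARD('n)}"
  shows "lam k \<ge> 0"
proof -
  obtain v where v: "v \<noteq> 0" "laplacian E D *v v = lam k *\<^sub>R v"
    using ordered_eigenvalues_eigenvector[OF assms] by blast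
  have "0 \<le> v \<bullet> (laplacian E D *v v)"
    unfolding laplacian_quadratic by (intro sum_nonneg) auto
  then have "0 \<le> lam k * (v \<bullet> v)" using v by simp
  moreover have "v \<bullet> v > 0" using v by simp
  ultimately show ?thesis by (simp add: zero_le_mult_iff)
qed

text \<open>Cauchy--Schwarz for the semidefinite form of the Laplacian, applied to \<open>z\<close> and \<open>L z\<close>.\<close>

lemma laplacian_cocoercive:
  fixes E :: "'n::finite set set"
  assumes lam: "ordered_eigenvalues (laplacian E D) lam"
  shows "(\<Sum>i\<in>UNIV. (\<Sum>j\<in>UNIV. laplacian E D $ i $ j * z j)\<^sup>2)
    \<le> lam CARD('n) * (\<Sum>i\<in>UNIV. z i * (\<Sum>j\<in>UNIV. laplacian E D $ i $ j * z j))"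
proof -
  define w where "w i = (\<Sum>j\<in>UNIV. laplacian E D $ i $ j * z j)" for i
  define B where "B y e = (\<Sum>i\<in>UNIV. D i e * y i)" for y :: "'n \<Rightarrow> real" and e
  define W where "W = (\<Sum>i\<in>UNIV. (w i)\<^sup>2)"
  define Q where "Q = (\<Sum>e\<in>E. (B z e)\<^sup>2)"
  have n: "CARD('n) \<in> {1..CARD('n)}" by (simp add: Suc_le_eq)
  have lam_nonneg: "lam CARD('n) \<ge> 0" using laplacian_eigenvalue_nonneg[OF lam n] .
  have Q: "(\<Sum>i\<in>UNIV. z i * w i) = Q"
    unfolding w_def Q_def B_def laplacian_bilinear by (simp add: power2_eq_square)
  have Q_nonneg: "Q \<ge> 0" unfolding Q_def by (intro sum_nonneg) auto
  have "W = (\<Sum>e\<in>E. B w e * B z e)"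
    unfolding W_def B_def using laplacian_bilinear[of w E D z]
    by (simp add: w_def[symmetric] power2_eq_square)
  then have "W\<^sup>2 \<le> (\<Sum>e\<in>E. (B w e)\<^sup>2) * Q"
    unfolding Q_def using Cauchy_Schwarz_ineq_sum by metis
  \<comment> \<open>Applying the spectral bound to \<open>w = L z\<close> itself brings back
    \<open>W\<close>, so that one factor \<open>W\<close> cancels below.\<close>
  also have "(\<Sum>e\<in>E. (B w e)\<^sup>2) \<le> lam CARD('n) * W"
    using ordered_eigenvalues_quadratic_bound[OF transpose_laplacian lam, of "\<chi> i. w i"]
    unfolding laplacian_quadratic by (simp add: B_def W_def inner_vec_def power2_eq_square)
  finally have le: "W\<^sup>2 \<le> lam CARD('n) * W * Q"
    using Q_nonneg by (simp add: mult_right_mono)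
  have "W \<le> lam CARD('n) * Q"
  proof (cases "W = 0")
    case False
    then have "W > 0" unfolding W_def by (metis less_eq_real_def sum_nonneg zero_le_power2)
    then show ?thesis using le by (simp add: power2_eq_square mult_ac)
  qed (use lam_nonneg Q_nonneg in simp)
  then show ?thesis using Q by (simp add: W_def w_def)
qed

text \<open>The factor \<open>D i {i, j}\<close> is the sign of \<open>i\<close> on the edge and
  cancels the arbitrary orientation.\<close>

lemma incidence_edge:
  fixes D :: "'n::finite \<Rightarrow> 'n set \<Rightarrow> real"
  assumes "incidence_matrix E D" "{i, j} \<in> E"
  shows "D i {i, j} * (\<Sum>k\<in>UNIV. D k {i, j} * z k) = z i - z j"
proof -
  define e where "e = {i, j}"
  obtain a b where ab: "a \<noteq> b" "e = {a, b}" "D a e = 1" "D b e = - 1" "\<And>k. k \<notin> e \<Longrightarrow> D k e = 0"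
    using assms unfolding incidence_matrix_def e_def by blast
  have "(\<Sum>k\<in>UNIV. D k e * z k) = (\<Sum>k\<in>{a, b}. D k e * z k)"
    using ab(2,5) by (intro sum.mono_neutral_right) auto
  also have "\<dots> = z a - z b" using ab(1,3,4) by simp
  finally have eq: "D i e * (\<Sum>k\<in>UNIV. D k e * z k) = D i e * (z a - z b)" by simp
  have "i = a \<and> j = b \<or> i = b \<and> j = a"
    using ab(2) by (auto simp: e_def doubleton_eq_iff)
  then have "D i e * (z a - z b) = z i - z j"
    using ab(3,4) by (elim disjE conjE) simp_all
  then have "D i e * (\<Sum>k\<in>UNIV. D k e * z k) = z i - z j" using eq by simp
  then show ?thesis by (simp only: e_def)
qed

text \<open>Row \<open>i\<close> of \<open>D\<close> vanishes on edges that avoid \<open>i\<close>,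
  and the edges at \<open>i\<close> correspond one to one to its neighbors. This identifies the
  feedback with \<open>- L\<close> applied to the samples in use.\<close>

lemma laplacian_neighbors:
  fixes D :: "'n::finite \<Rightarrow> 'n set \<Rightarrow> real"
  assumes inc: "incidence_matrix E D"
  shows "(\<Sum>j\<in>UNIV. laplacian E D $ i $ j * z j) = (\<Sum>j\<in>neighbors E i. z i - z j)"
proof -
  have zero: "D i e = 0" if e: "e \<in> E - (\<lambda>j. {i, j}) ` neighbors E i" for e
  proof -
    have "\<exists>a b. a \<noteq> b \<and> e = {a, b} \<and> D a e = 1 \<and> D b e = - 1 \<and> (\<forall>i. i \<notin> e \<longrightarrow> D i e = 0)"
      using inc DiffD1[OF e] by (simp only: incidence_matrix_def)
    then obtain a b where ab: "e = {a, b}" and D0: "\<forall>k. k \<notin> e \<longrightarrow> D k e = 0"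
      by (elim exE conjE)
    have "i \<noteq> a"
      using e unfolding ab neighbors_def by blast
    moreover have "i \<noteq> b"
      using e unfolding ab insert_commute[of a b] neighbors_def by blast
    ultimately show ?thesis using D0 ab by simp
  qed
  have "(\<Sum>j\<in>UNIV. laplacian E D $ i $ j * z j) = (\<Sum>e\<in>E. D i e * (\<Sum>j\<in>UNIV. D j e * z j))"
    by (rule laplacian_apply)
  also have "\<dots> = (\<Sum>e\<in>(\<lambda>j. {i, j}) ` neighbors E i. D i e * (\<Sum>j\<in>UNIV. D j e * z j))"
    by (intro sum.mono_neutral_right ballI) (auto simp: neighbors_def zero)
  also have "\<dots> = (\<Sum>j\<in>neighbors E i. D i {i, j} * (\<Sum>k\<in>UNIV. D k {i, j} * z k))"
    by (subst sum.reindex) (auto simp: inj_on_def doubleton_eq_iff)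
  also have "\<dots> = (\<Sum>j\<in>neighbors E i. z i - z j)"
    by (intro sum.cong refl incidence_edge[OF inc]) (simp add: neighbors_def)
  finally show ?thesis .
qed

text \<open>Keeps one square of the sum over edges; squaring removes the orientation sign. A
  vanishing form thus forces agreement across each edge.\<close>

lemma edge_difference_sq_le:
  fixes D :: "'n::finite \<Rightarrow> 'n set \<Rightarrow> real"
  assumes inc: "incidence_matrix E D" and e: "{a, b} \<in> E"
  shows "(z a - z b)\<^sup>2 \<le> (\<Sum>i\<in>UNIV. z i * (\<Sum>j\<in>UNIV. laplacian E D $ i $ j * z j))"
proof -
  have one: "(D a {a, b})\<^sup>2 = 1"
  proof -
    obtain c d where "{a, b} = {c, d}" "D c {a, b} = 1" "D d {a, b} = - 1"
      using inc e unfolding incidence_matrix_def by blast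
    moreover from this(1) have "a = c \<or> a = d" by (auto simp: doubleton_eq_iff)
    ultimately have "D a {a, b} = 1 \<or> D a {a, b} = - 1" by blast
    then show ?thesis by auto
  qed
  have "(z a - z b)\<^sup>2 = (D a {a, b} * (\<Sum>k\<in>UNIV. D k {a, b} * z k))\<^sup>2"
    by (simp only: incidence_edge[OF inc e])
  also have "\<dots> = (\<Sum>k\<in>UNIV. D k {a, b} * z k)\<^sup>2"
    by (simp only: power_mult_distrib one mult_1)
  also have "\<dots> \<le> (\<Sum>e\<in>E. (\<Sum>k\<in>UNIV. D k e * z k)\<^sup>2)"
    using e by (intro member_le_sum[of _ E "\<lambda>e. (\<Sum>k\<in>UNIV. D k e * z k)\<^sup>2"]) auto
  finally show ?thesis by (simp add: laplacian_bilinear power2_eq_square)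
qed

section \<open>Reduction of the sampling condition to a gain below 1\<close>

text \<open>For \<open>\<gamma> \<le> 1\<close> the numerator is nonpositive because
  \<open>\<sigma> \<ge> 2 * l2\<close>; for \<open>\<gamma> > 1\<close> the same inequality makes
  the denominator at least \<open>ln\<close>, while the numerator is at most
  \<open>l2\<close>.\<close>

lemma gain_ratio_le_1:
  fixes l2 ln \<gamma> \<sigma> :: real
  assumes "0 \<le> l2" "l2 \<le> ln" "2 * l2 \<le> \<sigma>" "\<gamma> > 0"
  shows "(l2 - \<sigma> / (2 * \<gamma>)) / (\<gamma> * \<sigma> / 2 + ln - l2) \<le> 1"
proof (cases "\<gamma> \<le> 1")
  case True
  have "l2 * \<gamma> \<le> \<sigma> / 2" using mult_left_mono[OF True, of l2] assms by simp
  then have "l2 - \<sigma> / (2 * \<gamma>) \<le> 0" using assms by (simp add: field_simps)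
  moreover have "\<gamma> * \<sigma> \<ge> 0" using assms by (intro mult_nonneg_nonneg) auto
  then have "\<gamma> * \<sigma> / 2 + ln - l2 \<ge> 0" using assms by linarith
  ultimately show ?thesis
    using divide_nonpos_nonneg by (meson order_trans zero_le_one)
next
  case False
  have "1 * (2 * l2) \<le> \<gamma> * \<sigma>" using False assms by (intro mult_mono) auto
  moreover have "\<sigma> / (2 * \<gamma>) \<ge> 0" using assms by simp
  moreover have "\<gamma> * \<sigma> \<ge> 0" using assms by (intro mult_nonneg_nonneg) auto
  ultimately have "l2 - \<sigma> / (2 * \<gamma>) \<le> \<gamma> * \<sigma> / 2 + ln - l2" "\<gamma> * \<sigma> / 2 + ln - l2 \<ge> 0"
    using assms by linarith+
  then show ?thesis by (auto simp: divide_le_eq_1)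
qed

lemma sampling_bound:
  fixes l2 ln \<sigma> r :: real
  assumes l: "0 \<le> l2" "l2 \<le> ln" "2 * l2 \<le> \<sigma>" and r: "r > 0"
    and less: "r\<^sup>2 < 3 / (7 * ln\<^sup>2) * (SUP \<gamma>\<in>{0<..}. (l2 - \<sigma> / (2 * \<gamma>)) / (\<gamma> * \<sigma> / 2 + ln - l2))"
  shows "ln > 0" "r * ln < 1"
proof -
  show ln: "ln > 0"
  proof (rule ccontr)
    assume "\<not> ln > 0"
    \<comment> \<open>Division by zero yields 0 on the right, so the hypothesis would read
      \<open>r\<^sup>2 < 0\<close>.\<close>
    then have "ln = 0" using l by simp
    then show False using less by simp
  qed
  have "(SUP \<gamma>\<in>{0<..}. (l2 - \<sigma> / (2 * \<gamma>)) / (\<gamma> * \<sigma> / 2 + ln - l2)) \<le> 1"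
    using l by (intro cSUP_least gain_ratio_le_1) auto
  then have "3 / (7 * ln\<^sup>2) * (SUP \<gamma>\<in>{0<..}. (l2 - \<sigma> / (2 * \<gamma>)) / (\<gamma> * \<sigma> / 2 + ln - l2)) \<le> 3 / (7 * ln\<^sup>2) * 1"
    by (intro mult_left_mono) auto
  then have "r\<^sup>2 < 3 / (7 * ln\<^sup>2)" using less by linarith
  then have "(r * ln)\<^sup>2 < 1\<^sup>2" using ln by (simp add: field_simps power_mult_distrib)
  then show "r * ln < 1" by (rule power2_less_imp_less) simp
qed

section \<open>The broadcasting protocol\<close>

lemma exists_hold_period:
  assumes T: "filterlim T at_top sequentially" and d: "\<And>k. 0 \<le> d k" and t: "T 0 + d 0 \<le> t"
  shows "\<exists>k. t \<in> hold_period T d k"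
proof -
  have "eventually (\<lambda>k. t + 1 \<le> T k) sequentially"
    using T by (simp add: filterlim_at_top)
  then obtain N where "t + 1 \<le> T N" by (auto simp: eventually_sequentially)
  then have N: "t < T N + d N" using d[of N] by linarith
  define k where "k = (LEAST k. t < T k + d k)"
  have k: "t < T k + d k" unfolding k_def using N by (rule LeastI)
  \<comment> \<open>The first sample has already arrived, so the least index has a predecessor,
    whose period contains \<open>t\<close>.\<close>
  then have "k \<noteq> 0" using t by (cases k) auto
  then obtain l where l: "k = Suc l" by (cases k) auto
  have "\<not> t < T l + d l"
    by (rule not_less_Least[of l "\<lambda>k. t < T k + d k"]) (simp add: l flip: k_def)
  then have "t \<in> hold_period T d l" using k l by (simp add: hold_period_def)
  then show ?thesis ..
qed

lemma sampling_instant_nonneg: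
  fixes T :: "nat \<Rightarrow> real"
  assumes "0 \<le> T 0" "\<And>k. T k < T (Suc k)"
  shows "0 \<le> T k"
proof (induction k)
  case (Suc k)
  then show ?case using assms(2)[of k] by linarith
qed (rule assms)

text \<open>There are finitely many agents, and each has finitely many updates up to
  \<open>b\<close>: its sampling instants diverge and delays only postpone them.\<close>

lemma finite_updates:
  fixes T d :: "'n::finite \<Rightarrow> nat \<Rightarrow> real"
  assumes T: "\<And>i. filterlim (T i) at_top sequentially" and d: "\<And>i k. 0 \<le> d i k"
  shows "finite ({t. \<exists>j k. t = T j k + d j k} \<inter> {a..b})"
proof -
  have "finite {k. T j k + d j k \<le> b}" for j
  proof -
    have "eventually (\<lambda>k. b + 1 \<le> T j k) sequentially"
      using T[of j] by (simp add: filterlim_at_top)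
    then obtain N where N: "\<And>k. N \<le> k \<Longrightarrow> b + 1 \<le> T j k" by (auto simp: eventually_sequentially)
    have "k < N" if "T j k + d j k \<le> b" for k
      using N[of k] d[of j k] that by (cases "N \<le> k") auto
    then have "{k. T j k + d j k \<le> b} \<subseteq> {..<N}" by auto
    then show ?thesis by (rule finite_subset) simp
  qed
  then have "finite (\<Union>j. (\<lambda>k. T j k + d j k) ` {k. T j k + d j k \<le> b})"
    by (intro finite_UN_I finite_imageI) auto
  moreover have "{t. \<exists>j k. t = T j k + d j k} \<inter> {a..b}
      \<subseteq> (\<Union>j. (\<lambda>k. T j k + d j k) ` {k. T j k + d j k \<le> b})"
  proof
    fix t assume "t \<in> {t. \<exists>j k. t = T j k + d j k} \<inter> {a..b}"
    then obtain j k where "t = T j k + d j k" "T j k + d j k \<le> b" by auto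
    then have "t \<in> (\<lambda>k. T j k + d j k) ` {k. T j k + d j k \<le> b}" by simp
    then show "t \<in> (\<Union>j. (\<lambda>k. T j k + d j k) ` {k. T j k + d j k \<le> b})" by blast
  qed
  ultimately show ?thesis by (rule rev_finite_subset)
qed

text \<open>The contributions of an edge to its two ends are opposite. If either end lacks data both
  are 0, so the cancellation also holds during start-up.\<close>

lemma sum_broadcast_control: "(\<Sum>i\<in>UNIV. broadcast_control E T d x i t) = 0"
proof -
  define g where "g i j = (case (held (T j) (d j) (x j) t, held (T i) (d i) (x i) t) of
      (Some a, Some b) \<Rightarrow> a - b | _ \<Rightarrow> 0)" for i j
  define f where "f i j = (if {i, j} \<in> E then g i j else 0)" for i j
  have g: "g i j = - g j i" for i j
    by (simp add: g_def split: option.split)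
  have f: "f i j = - f j i" for i j
    using insert_commute[of i j "{}"] by (simp add: f_def g[of i j])
  have "(\<Sum>j\<in>UNIV. \<Sum>i\<in>UNIV. f i j) = (\<Sum>j\<in>UNIV. \<Sum>i\<in>UNIV. - f j i)"
    by (intro sum.cong refl f)
  then have "(\<Sum>j\<in>UNIV. \<Sum>i\<in>UNIV. f i j) = - (\<Sum>j\<in>UNIV. \<Sum>i\<in>UNIV. f j i)"
    by (simp only: sum_negf)
  moreover have "(\<Sum>j\<in>UNIV. \<Sum>i\<in>UNIV. f i j) = (\<Sum>i\<in>UNIV. \<Sum>j\<in>UNIV. f i j)"
    by (rule sum.swap)
  moreover have "broadcast_control E T d x i t = (\<Sum>j\<in>UNIV. f i j)" for i
    unfolding broadcast_control_def f_def g_def[symmetric] neighbors_def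
    by (simp add: sum.If_cases)
  ultimately show ?thesis by simp
qed

text \<open>Start-up is included, so the average reached is that of the initial states and not
  merely that at the time when all data have arrived.\<close>

lemma average_conserved:
  fixes x :: "'n::finite \<Rightarrow> real \<Rightarrow> real"
  assumes S: "\<And>a b. finite ({t. \<exists>j k. t = T j k + d j k} \<inter> {a..b})"
    and sol: "closed_loop_solution E T d x" and t: "0 \<le> t"
  shows "(\<Sum>i\<in>UNIV. x i t) = (\<Sum>i\<in>UNIV. x i 0)"
proof -
  have cont: "continuous_on {0..t} (\<lambda>s. \<Sum>i\<in>UNIV. x i s)"
    using sol unfolding closed_loop_solution_def
    by (intro continuous_on_sum) (auto intro: continuous_on_subset)
  have deriv: "((\<lambda>s. \<Sum>i\<in>UNIV. x i s) has_real_derivative 0) (at s)"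
    if s: "0 < s" "s \<notin> {t. \<exists>j k. t = T j k + d j k}" for s
  proof -
    have "(x i has_real_derivative broadcast_control E T d x i s) (at s)" for i
      using sol s by (simp add: closed_loop_solution_def)
    then have "((\<lambda>s. \<Sum>i\<in>UNIV. x i s) has_real_derivative (\<Sum>i\<in>UNIV. broadcast_control E T d x i s)) (at s)"
      by (rule DERIV_sum)
    then show ?thesis by (simp add: sum_broadcast_control)
  qed
  have "(\<Sum>i\<in>UNIV. x i t) - (\<Sum>i\<in>UNIV. x i 0) \<le> 0 * (t - 0)"
    by (rule increment_le[OF S t cont deriv]) auto
  moreover have "- (\<Sum>i\<in>UNIV. x i t) - - (\<Sum>i\<in>UNIV. x i 0) \<le> 0 * (t - 0)"
    by (rule increment_le[OF S t continuous_on_minus[OF cont] DERIV_minus[OF deriv]]) auto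
  ultimately show ?thesis by simp
qed

theorem theorem3:
  fixes E :: "'n::finite set set"
    and D :: "'n \<Rightarrow> 'n set \<Rightarrow> real"
    and lam :: "nat \<Rightarrow> real"
    and T d :: "'n \<Rightarrow> nat \<Rightarrow> real"
    and x :: "'n \<Rightarrow> real \<Rightarrow> real"
    and h \<tau> \<sigma> :: real
  assumes "CARD('n) \<ge> 2"
    and "simple_graph E"
    and "connected_graph E"
    and "incidence_matrix E D"
    and "ordered_eigenvalues (laplacian E D) lam"
    and "\<sigma> = max (2 * lam 2) (lam CARD('n) - 2 * lam 2)"
    and "h > 0" and "\<tau> \<ge> 0"
    and "\<And>i. 0 \<le> T i 0"
    and "\<And>i k. T i k < T i (Suc k)"
    and "\<And>i. filterlim (T i) at_top sequentially"
    and "\<And>i k. 0 \<le> d i k"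
    and "\<And>i k. T i (Suc k) - T i k \<le> h"
    and "\<And>i k. d i k < T i (Suc k) - T i k"
    and "\<And>i k. d i k \<le> \<tau>"
    and "closed_loop_solution E T d x"
    and "(h + \<tau>)^2 < 3 / (7 * (lam CARD('n))^2) *
           (SUP \<gamma>\<in>{0<..}. (lam 2 - \<sigma> / (2 * \<gamma>)) / (\<gamma> * \<sigma> / 2 + lam CARD('n) - lam 2))"
  shows "\<forall>i. ((\<lambda>t. x i t - (\<Sum>j\<in>UNIV. x j 0) / real CARD('n)) \<longlongrightarrow> 0) at_top"
proof -
  note n = assms(1) and inc = assms(4) and eig = assms(5) and T0 = assms(9) and Tinc = assms(10)
    and Tlim = assms(11) and d0 = assms(12) and Th = assms(13) and dT = assms(14)
    and d\<tau> = assms(15) and sol = assms(16)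
  define S where "S = {t. \<exists>j k. t = T j k + d j k}"
  define r where "r = h + \<tau>"
  \<comment> \<open>From \<open>t0\<close> on every agent has a sample in use, so there
    \<open>the\<close> in \<open>xh\<close> is applied to a genuine value.\<close>
  define t0 where "t0 = Max (range (\<lambda>i. T i 0 + d i 0))"
  define xh where "xh i t = the (held (T i) (d i) (x i) t)" for i t
  define A where "A i j = laplacian E D $ i $ j" for i j
  have t0: "T i 0 + d i 0 \<le> t0" for i unfolding t0_def by (intro Max_ge) auto
  have hold: "\<exists>k. t \<in> hold_period (T i) (d i) k" if "t \<ge> t0" for i t
    using Tlim d0 order_trans[OF t0 that] by (rule exists_hold_period)
  have held: "held (T i) (d i) (x i) t = Some (x i (T i k))" if "t \<in> hold_period (T i) (d i) k" for i t k
    using Tinc d0 dT that by (rule held_eq)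
  have "lam 2 \<ge> 0" using laplacian_eigenvalue_nonneg[OF eig, of 2] n by simp
  moreover have "lam 2 \<le> lam CARD('n)"
    using eig n by (auto simp: ordered_eigenvalues_def intro: mono_onD)
  moreover have "2 * lam 2 \<le> \<sigma>" "r > 0" using assms(6-8) by (simp_all add: r_def)
  ultimately have lam: "lam CARD('n) > 0" "r * lam CARD('n) < 1"
    using sampling_bound[OF _ _ _ _ assms(17)[folded r_def]] by blast+
  have S: "finite (S \<inter> {a..b})" for a b
    unfolding S_def by (rule finite_updates[OF Tlim d0])
  interpret delayed_flow S x xh A r "lam CARD('n)" t0
  proof
    show "0 < r" using assms(7,8) by (simp add: r_def)
    show "0 \<le> t0" using T0[of undefined] d0[of undefined 0] t0[of undefined] by linarith
    show "continuous_on {0..} (x i)" for i using sol by (simp add: closed_loop_solution_def)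
    show "finite (S \<inter> {a..b})" for a b by (rule S)
    show "0 < lam CARD('n)" "r * lam CARD('n) < 1" using lam .
    show "(\<Sum>i\<in>UNIV. (\<Sum>j\<in>UNIV. A i j * z j)\<^sup>2)
        \<le> lam CARD('n) * (\<Sum>i\<in>UNIV. z i * (\<Sum>j\<in>UNIV. A i j * z j))" for z
      unfolding A_def by (rule laplacian_cocoercive[OF eig])
  next
    fix t i assume t: "t > t0" "t \<notin> S"
    have "0 < t" using t(1) t0[of i] T0[of i] d0[of i 0] by linarith
    then have "(x i has_real_derivative broadcast_control E T d x i t) (at t)"
      using sol t(2) by (simp add: closed_loop_solution_def S_def)
    moreover have "held (T j) (d j) (x j) t = Some (xh j t)" for j
    proof -
      obtain k where "t \<in> hold_period (T j) (d j) k" using hold[of t j] t(1) by auto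
      then show ?thesis by (simp add: xh_def held)
    qed
    then have "broadcast_control E T d x i t = - (\<Sum>j\<in>neighbors E i. xh i t - xh j t)"
      by (simp add: broadcast_control_def flip: sum_negf)
    ultimately show "(x i has_real_derivative - (\<Sum>j\<in>UNIV. A i j * xh j t)) (at t)"
      unfolding A_def laplacian_neighbors[OF inc] by simp
  next
    fix t i assume t: "t > t0" "t \<notin> S"
    obtain k where k: "t \<in> hold_period (T i) (d i) k" using hold[of t i] t(1) by auto
    \<comment> \<open>Off the update instants \<open>t\<close> is interior to its hold period, so
      \<open>xh i\<close> is locally constant.\<close>
    have "T i k + d i k \<noteq> t" using t(2) by (auto simp: S_def)
    then have "t \<in> {T i k + d i k<..<T i (Suc k) + d i (Suc k)}"
      using k by (auto simp: hold_period_def)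
    then have "eventually (\<lambda>s. s \<in> {T i k + d i k<..<T i (Suc k) + d i (Suc k)}) (nhds t)"
      by (intro eventually_nhds_in_open) auto
    then have "eventually (\<lambda>s. xh i s = x i (T i k)) (nhds t)"
    proof eventually_elim
      case (elim s)
      then have "s \<in> hold_period (T i) (d i) k" by (simp add: hold_period_def)
      then show ?case by (simp add: xh_def held)
    qed
    then show "isCont (xh i) t"
      by (simp add: isCont_cong)
  next
    fix t i assume t: "t \<ge> t0"
    obtain k where k: "t \<in> hold_period (T i) (d i) k" using hold[OF t] by blast
    have "0 \<le> T i k" using T0 Tinc by (rule sampling_instant_nonneg)
    \<comment> \<open>Sample \<open>k\<close> is replaced at
      \<open>T i (Suc k) + d i (Suc k)\<close>, at most \<open>h + \<tau>\<close> after it was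
      taken.\<close>
    moreover have "t - r \<le> T i k" "T i k \<le> t"
      using k Th[of i k] d\<tau>[of i "Suc k"] d0[of i k] by (auto simp: hold_period_def r_def)
    moreover have "xh i t = x i (T i k)" by (simp add: xh_def held[OF k])
    ultimately show "\<exists>s\<ge>0. t - r \<le> s \<and> s \<le> t \<and> xh i t = x i s" by blast
  qed
  obtain C where C: "\<And>t. t \<ge> t0 + r \<Longrightarrow> (\<Sum>i\<in>UNIV. (x i t)\<^sup>2) \<le> C"
    using energy_bounded by metis
  define Q where "Q t = (\<Sum>i\<in>UNIV. x i t * (\<Sum>j\<in>UNIV. A i j * x j t))" for t
  \<comment> \<open>A bounded state is paired with a vanishing coupling term.\<close>
  have "(Q \<longlongrightarrow> 0) at_top"
  proof (rule Lim_null_comparison)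
    show "((\<lambda>t. \<Sum>i\<in>UNIV. sqrt C * \<bar>\<Sum>j\<in>UNIV. A i j * x j t\<bar>) \<longlongrightarrow> 0) at_top"
      by (intro tendsto_null_sum tendsto_mult_right_zero tendsto_rabs_zero coupling_tendsto_0)
    have "norm (Q t) \<le> (\<Sum>i\<in>UNIV. sqrt C * \<bar>\<Sum>j\<in>UNIV. A i j * x j t\<bar>)" if t: "t \<ge> t0 + r" for t
    proof -
      have "\<bar>x i t\<bar> \<le> sqrt C" for i
      proof (rule real_le_rsqrt)
        have "(x i t)\<^sup>2 \<le> (\<Sum>i\<in>UNIV. (x i t)\<^sup>2)"
          by (rule member_le_sum[of i UNIV "\<lambda>i. (x i t)\<^sup>2"]) auto
        then show "\<bar>x i t\<bar>\<^sup>2 \<le> C" using C[OF t] by simp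
      qed
      then have "\<bar>x i t * (\<Sum>j\<in>UNIV. A i j * x j t)\<bar> \<le> sqrt C * \<bar>\<Sum>j\<in>UNIV. A i j * x j t\<bar>" for i
        unfolding abs_mult by (rule mult_right_mono) simp
      then show ?thesis
        unfolding Q_def real_norm_def by (rule order_trans[OF sum_abs sum_mono])
    qed
    then show "\<forall>\<^sub>F t in at_top. norm (Q t) \<le> (\<Sum>i\<in>UNIV. sqrt C * \<bar>\<Sum>j\<in>UNIV. A i j * x j t\<bar>)"
      by (rule eventually_at_top_linorderI)
  qed
  from tendsto_real_sqrt[OF this] have sqrtQ: "((\<lambda>t. sqrt (Q t)) \<longlongrightarrow> 0) at_top"
    by simp
  have edge: "((\<lambda>t. x a t - x b t) \<longlongrightarrow> 0) at_top" if ab: "{a, b} \<in> E" for a b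
  proof (rule Lim_null_comparison[OF always_eventually sqrtQ], rule allI)
    show "norm (x a t - x b t) \<le> sqrt (Q t)" for t
      unfolding real_norm_def
    proof (rule real_le_rsqrt)
      show "\<bar>x a t - x b t\<bar>\<^sup>2 \<le> Q t"
        using edge_difference_sq_le[OF inc ab, of "\<lambda>i. x i t"] by (simp add: Q_def A_def)
    qed
  qed
  have pair: "((\<lambda>t. x i t - x j t) \<longlongrightarrow> 0) at_top" for i j
  proof -
    have "rtranclp (\<lambda>a b. {a, b} \<in> E) i j"
      using assms(3) by (simp add: connected_graph_def)
    then show ?thesis
    proof induction
      case (step b c)
      then show ?case using tendsto_add[OF step.IH edge[of b c]] by simp
    qed simp
  qed
  show ?thesis
  proof
    fix i
    \<comment> \<open>The mean of the differences is the deviation of \<open>x i\<close> from the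
      current average, which equals the initial one.\<close>
    have "((\<lambda>t. (\<Sum>j\<in>UNIV. x i t - x j t) / real CARD('n)) \<longlongrightarrow> 0) at_top"
      by (intro tendsto_divide_zero tendsto_null_sum pair)
    moreover have "eventually (\<lambda>t. (\<Sum>j\<in>UNIV. x i t - x j t) / real CARD('n)
        = x i t - (\<Sum>j\<in>UNIV. x j 0) / real CARD('n)) at_top"
      using eventually_ge_at_top[of 0]
    proof eventually_elim
      case (elim t)
      then show ?case
        using average_conserved[OF S[unfolded S_def] sol elim]
        by (simp add: sum_subtractf diff_divide_distrib)
    qed
    ultimately show "((\<lambda>t. x i t - (\<Sum>j\<in>UNIV. x j 0) / real CARD('n)) \<longlongrightarrow> 0) at_top"
      by (rule Lim_transform_eventually)
  qed
qed

end
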